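(* For each positive integer $n$, let $S_n=\{0,5,10,15,\dots,5n\rightarrow\}=\{5k \mid 0\le k\le n\}\cup\{x\in\mathbb{Z} \mid x\geq 5n\}$. Then $t(S_n)=4$ and $P(S_n)=2n+4$, where $t(S_n)$ is the type of the numerical semigroup $S_n$ and $P(S_n)$ is the number of numerical sets $T$ with $A(T)=S_n$.
   Context: A numerical set $T$ is a subset of $\mathbb{N}_0=\{0,1,2,\dots\}$ containing $0$ with finite complement. A numerical semigroup is a numerical set closed under addition. The atom monoid of $T$ is $A(T)=\{x\in\mathbb{N}_0 \mid x+T\subseteq T\}$. The pseudo-Frobenius numbers of a numerical semigroup $S$ are $PF(S)=\{P\in \mathbb{N}_0\setminus S \mid P+s\in S \text{ for all } s\in S\setminus\{0\}\}$, and the type of $S$ is $t(S)=|PF(S)|$. The arrow $\rightarrow$ indicates that all integers larger than the preceding one belong to the set. *)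

theory Defs
  imports Main
begin

definition numerical_set :: "nat set \<Rightarrow> bool" where
  "numerical_set T \<longleftrightarrow> 0 \<in> T \<and> finite (- T)"

definition numerical_semigroup :: "nat set \<Rightarrow> bool" where
  "numerical_semigroup S \<longleftrightarrow> numerical_set S \<and> (\<forall>x\<in>S. \<forall>y\<in>S. x + y \<in> S)"

definition atom_monoid :: "nat set \<Rightarrow> nat set" where
  "atom_monoid T = {x. (\<lambda>t. x + t) ` T \<subseteq> T}"

definition pseudo_frobenius :: "nat set \<Rightarrow> nat set" where
  "pseudo_frobenius S = {P. P \<notin> S \<and> (\<forall>s\<in>S - {0}. P + s \<in> S)}"

definition semigroup_type :: "nat set \<Rightarrow> nat" where
  "semigroup_type S = card (pseudo_frobenius S)"

(* card is 0 on infinite sets, but for a numerical semigroup S the sets counted in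
   semigroup_type S and in num_assoc_sets S are finite: pseudo-Frobenius numbers are gaps
   of S, and A(T) = S forces S \<subseteq> T because 0 \<in> T. *)

definition num_assoc_sets :: "nat set \<Rightarrow> nat" where
  "num_assoc_sets S = card {T. numerical_set T \<and> atom_monoid T = S}"

definition S_fam :: "nat \<Rightarrow> nat set" where
  "S_fam n = {5 * k |k. k \<le> n} \<union> {x. x \<ge> 5 * n}"

lemma numerical_semigroup_S_fam: "numerical_semigroup (S_fam n)"
proof -
  have "- S_fam n \<subseteq> {..<5 * n}"
    by (auto simp: S_fam_def)
  then have "finite (- S_fam n)"
    by (rule finite_subset) simp
  moreover have "x + y \<in> S_fam n" if "x \<in> S_fam n" "y \<in> S_fam n" for x y
  proof (cases "x + y \<ge> 5 * n")
    case True
    then show ?thesis by (simp add: S_fam_def)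
  next
    case False
    with that obtain j k where "x = 5 * j" "y = 5 * k"
      by (auto simp: S_fam_def)
    with False have "x + y = 5 * (j + k)" "j + k \<le> n" by auto
    then show ?thesis unfolding S_fam_def by blast
  qed
  ultimately show ?thesis
    by (auto simp: numerical_semigroup_def numerical_set_def S_fam_def)
qed

end

theory Submission
  imports Defs
begin

text \<open>
  A set \<open>T\<close> with \<open>A(T) = S\<^sub>n\<close> is closed under adding 5, so it is determined by the least
  quotients \<open>a r\<close> of its elements in the residue classes \<open>r\<close> modulo 5. Here \<open>a 0 = 0\<close>,
  \<open>a 4 = n\<close> (because \<open>5n - 1\<close> is the largest gap) and \<open>a 1, a 2, a 3\<close> are at most \<open>n\<close>.
  Conversely such a \<open>T\<close> satisfies \<open>S\<^sub>n \<subseteq> A(T)\<close>, and equality holds iff none of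
  \<open>5n - 4, \<dots>, 5n - 1\<close> lies in \<open>A(T)\<close>. This is a finite Boolean condition on the equalities
  \<open>a i = 0\<close> and \<open>a i = n\<close>, whose solutions \<open>(a 1, a 2, a 3)\<close> are \<open>(i, 0, n)\<close> and \<open>(0, n, i)\<close>
  for \<open>i \<le> n\<close>, together with \<open>(0, 0, 0)\<close> and \<open>(n, n, n)\<close>.
\<close>

section \<open>Sets given by a threshold in each residue class\<close>

text \<open>For a numerical semigroup containing \<open>m\<close>, the values \<open>a r\<close>
  with \<open>0 < r < m\<close> are its Kunz coordinates.\<close>

definition residue_set :: "nat \<Rightarrow> (nat \<Rightarrow> nat) \<Rightarrow> nat set" where
  "residue_set m a = {x. a (x mod m) \<le> x div m}"

lemma mem_residue_set: "r < m \<Longrightarrow> m * k + r \<in> residue_set m a \<longleftrightarrow> a r \<le> k"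
  by (simp add: residue_set_def)

lemma residue_set_eqD:
  assumes "residue_set m a = residue_set m b" "r < m"
  shows "a r = b r"
  using assms mem_residue_set[of r m "a r" a] mem_residue_set[of r m "a r" b]
    mem_residue_set[of r m "b r" a] mem_residue_set[of r m "b r" b]
  by auto

lemma residue_set_cong: "m > 0 \<Longrightarrow> (\<And>r. r < m \<Longrightarrow> a r = b r) \<Longrightarrow> residue_set m a = residue_set m b"
  by (simp add: residue_set_def)

text \<open>It suffices to translate the least element \<open>m * a r + r\<close> of each class,
  since the set is closed under adding \<open>m\<close>; the carry \<open>(x + r) div m\<close> goes
  into the quotient.\<close>

lemma mem_atom_monoid_residue_set:
  assumes "m > 0"
  shows "x \<in> atom_monoid (residue_set m a) \<longleftrightarrow>
    (\<forall>r<m. a ((x + r) mod m) \<le> a r + (x + r) div m)"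
proof -
  have *: "x + (m * k + r) \<in> residue_set m a \<longleftrightarrow> a ((x + r) mod m) \<le> k + (x + r) div m" for k r
  proof -
    have "x + (m * k + r) = (x + r) + m * k" by simp
    then show ?thesis
      using assms by (simp only: residue_set_def mem_Collect_eq mod_mult_self2 div_mult_self2)
  qed
  show ?thesis
  proof
    assume x: "x \<in> atom_monoid (residue_set m a)"
    show "\<forall>r<m. a ((x + r) mod m) \<le> a r + (x + r) div m"
    proof (intro allI impI)
      fix r assume "r < m"
      then have "m * a r + r \<in> residue_set m a" by (simp add: mem_residue_set)
      with x have "x + (m * a r + r) \<in> residue_set m a"
        unfolding atom_monoid_def by blast
      then show "a ((x + r) mod m) \<le> a r + (x + r) div m" by (simp only: *)
    qed
  next
    assume ineq: "\<forall>r<m. a ((x + r) mod m) \<le> a r + (x + r) div m"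
    have "x + t \<in> residue_set m a" if t: "t \<in> residue_set m a" for t
    proof -
      define r where "r = t mod m"
      define k where "k = t div m"
      have "a ((x + r) mod m) \<le> a r + (x + r) div m"
        using ineq assms by (simp add: r_def)
      moreover have "a r \<le> k" using t by (simp add: residue_set_def r_def k_def)
      ultimately have "x + (m * k + r) \<in> residue_set m a" unfolding * by linarith
      then show ?thesis by (simp add: r_def k_def)
    qed
    then show "x \<in> atom_monoid (residue_set m a)"
      unfolding atom_monoid_def by blast
  qed
qed

text \<open>Closure under adding \<open>m\<close> makes each class an upward ray, and
  \<open>ex\<close> makes every ray nonempty, so that \<open>LEAST\<close> picks its starting
  point.\<close>

lemma residue_set_Least:
  assumes m: "m > 0" and add: "\<And>t. t \<in> T \<Longrightarrow> m + t \<in> T"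
    and ex: "\<And>r. r < m \<Longrightarrow> \<exists>k. m * k + r \<in> T"
  shows "T = residue_set m (\<lambda>r. LEAST k. m * k + r \<in> T)"
proof -
  have up: "m * j + t \<in> T" if "t \<in> T" for j t
    by (induction j) (use that add in \<open>auto simp: add.assoc\<close>)
  show ?thesis
  proof (rule set_eqI)
    fix x
    let ?r = "x mod m" and ?k = "LEAST k. m * k + x mod m \<in> T"
    have least: "m * ?k + ?r \<in> T" using ex[of ?r] m by (auto intro: LeastI_ex)
    have "x \<in> T \<longleftrightarrow> ?k \<le> x div m"
    proof
      assume "x \<in> T"
      then show "?k \<le> x div m" by (intro Least_le) simp
    next
      assume "?k \<le> x div m"
      then have "m * (x div m - ?k) + m * ?k = m * (x div m)"
        by (simp only: le_add_diff_inverse2 flip: add_mult_distrib2)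
      with up[OF least, of "x div m - ?k"] show "x \<in> T" by (simp flip: add.assoc)
    qed
    then show "x \<in> T \<longleftrightarrow> x \<in> residue_set m (\<lambda>r. LEAST k. m * k + r \<in> T)"
      by (simp add: residue_set_def)
  qed
qed

section \<open>Pseudo-Frobenius numbers of the family\<close>

lemma mem_S_fam: "x \<in> S_fam n \<longleftrightarrow> x mod 5 = 0 \<or> 5 * n \<le> x"
proof
  assume "x mod 5 = 0 \<or> 5 * n \<le> x"
  then show "x \<in> S_fam n"
  proof (cases "5 * n \<le> x")
    case False
    with \<open>x mod 5 = 0 \<or> 5 * n \<le> x\<close> have "x = 5 * (x div 5)" "x div 5 \<le> n" by auto
    then show ?thesis unfolding S_fam_def by blast
  qed (simp add: S_fam_def)
qed (auto simp: S_fam_def)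

text \<open>Testing \<open>s = 5\<close> forces a gap \<open>x\<close> to satisfy
  \<open>5 * n \<le> x + 5\<close>; this suffices because every nonzero element is at least
  5.\<close>

lemma pseudo_frobenius_S_fam:
  assumes "n \<ge> 1"
  shows "pseudo_frobenius (S_fam n) = {5 * n - 4, 5 * n - 3, 5 * n - 2, 5 * n - 1}"
proof (rule set_eqI)
  fix x
  have "x \<in> pseudo_frobenius (S_fam n) \<longleftrightarrow> x mod 5 \<noteq> 0 \<and> x < 5 * n \<and> 5 * n \<le> x + 5"
  proof
    assume x: "x \<in> pseudo_frobenius (S_fam n)"
    have "5 \<in> S_fam n - {0}" by (simp add: mem_S_fam)
    with x have "x + 5 \<in> S_fam n" unfolding pseudo_frobenius_def by blast
    with x show "x mod 5 \<noteq> 0 \<and> x < 5 * n \<and> 5 * n \<le> x + 5"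
      by (auto simp: pseudo_frobenius_def mem_S_fam)
  next
    assume x: "x mod 5 \<noteq> 0 \<and> x < 5 * n \<and> 5 * n \<le> x + 5"
    have "x + s \<in> S_fam n" if "s \<in> S_fam n - {0}" for s
    proof -
      have "s \<ge> 5" using that assms by (auto simp: mem_S_fam)
      with x show ?thesis by (simp add: mem_S_fam)
    qed
    with x show "x \<in> pseudo_frobenius (S_fam n)"
      by (auto simp: pseudo_frobenius_def mem_S_fam)
  qed
  also have "\<dots> \<longleftrightarrow> x \<in> {5 * n - 4, 5 * n - 3, 5 * n - 2, 5 * n - 1}"
  proof -
    obtain m where m: "n = Suc m" using assms by (cases n) auto
    have "x mod 5 \<noteq> 0 \<and> x < 5 * n \<and> 5 * n \<le> x + 5 \<longleftrightarrow>
        x mod 5 \<noteq> 0 \<and> x \<in> {5 * m, 5 * m + 1, 5 * m + 2, 5 * m + 3, 5 * m + 4}"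
      unfolding m by auto
    also have "\<dots> \<longleftrightarrow> x \<in> {5 * m + 1, 5 * m + 2, 5 * m + 3, 5 * m + 4}"
      by (auto simp del: One_nat_def add_Suc_right add_2_eq_Suc')
    finally show ?thesis by (simp add: m add.commute)
  qed
  finally show "x \<in> pseudo_frobenius (S_fam n) \<longleftrightarrow>
    x \<in> {5 * n - 4, 5 * n - 3, 5 * n - 2, 5 * n - 1}" .
qed

section \<open>The Boolean condition on the thresholds\<close>

lemma all_less_5: "(\<forall>r<5::nat. P r) \<longleftrightarrow> P 0 \<and> P 1 \<and> P 2 \<and> P 3 \<and> P 4"
  by (auto simp: numeral_eq_Suc less_Suc_eq)

text \<open>The three conjuncts exclude, in this order, \<open>5 * n - 2\<close>,
  \<open>5 * n - 3\<close> and \<open>5 * n - 4\<close> from the atom monoid;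
  \<open>5 * n - 1\<close> is excluded by \<open>a 4 = n\<close>.\<close>

lemma atom_monoid_residue_set_eq_S_fam:
  fixes a :: "nat \<Rightarrow> nat"
  assumes n: "n \<ge> 1" and a: "a 0 = 0" "a 4 = n" "a 1 \<le> n" "a 2 \<le> n" "a 3 \<le> n"
  shows "atom_monoid (residue_set 5 a) = S_fam n \<longleftrightarrow>
    (a 3 = n \<or> a 1 = 0) \<and>
    (a 2 = n \<or> a 2 = 0 \<or> a 1 = 0 \<and> a 3 = n) \<and>
    (a 1 = n \<or> a 3 = 0 \<or> a 1 = 0 \<and> a 2 = n \<or> a 2 = 0 \<and> a 3 = n)" (is "?L \<longleftrightarrow> ?R")
proof -
  let ?A = "atom_monoid (residue_set 5 a)"
  have mem: "5 * q + s \<in> ?A \<longleftrightarrow> (\<forall>r<5. a ((s + r) mod 5) \<le> a r + (q + (s + r) div 5))" for q s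
  proof -
    have "(5 * q + s + r) mod 5 = (s + r) mod 5" "(5 * q + s + r) div 5 = q + (s + r) div 5" for r
      by (simp_all only: add.assoc mod_mult_self4 div_mult_self4)
    then show ?thesis by (simp add: mem_atom_monoid_residue_set)
  qed
  have "5 * q + 0 \<in> ?A" for q
    unfolding mem all_less_5 by (simp flip: numeral_2_eq_2)
  then have mem0: "5 * q \<in> ?A" for q by simp
  have mem1: "5 * q + 1 \<in> ?A \<longleftrightarrow> a 1 \<le> q \<and> a 2 \<le> a 1 + q \<and> a 3 \<le> a 2 + q \<and> n \<le> a 3 + q" for q
    unfolding mem all_less_5 using a by (simp flip: numeral_2_eq_2)
  have mem2: "5 * q + 2 \<in> ?A \<longleftrightarrow> a 2 \<le> q \<and> a 3 \<le> a 1 + q \<and> n \<le> a 2 + q" for q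
    unfolding mem all_less_5 using a by (auto simp flip: numeral_2_eq_2)
  have mem3: "5 * q + 3 \<in> ?A \<longleftrightarrow> a 3 \<le> q \<and> n \<le> a 1 + q \<and> a 1 \<le> Suc (a 3 + q)" for q
    unfolding mem all_less_5 using a by (auto simp flip: numeral_2_eq_2)
  have mem4: "5 * q + 4 \<in> ?A \<longleftrightarrow> n \<le> q" for q
    unfolding mem all_less_5 using a by (auto simp flip: numeral_2_eq_2)
  obtain m where m: "n = Suc m" using n by (cases n) auto
  have rep: "\<exists>q. x = 5 * q \<or> x = 5 * q + 1 \<or> x = 5 * q + 2 \<or> x = 5 * q + 3 \<or> x = 5 * q + 4"
    for x :: nat
    by presburger
  have S_sub: "x \<in> ?A" if "x \<in> S_fam n" for x
  proof -
    obtain q where q: "x = 5 * q \<or> x = 5 * q + 1 \<or> x = 5 * q + 2 \<or> x = 5 * q + 3 \<or> x = 5 * q + 4"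
      using rep by blast
    show ?thesis
    proof (cases "x = 5 * q")
      case True
      with mem0 show ?thesis by simp
    next
      case False
      with q have "x mod 5 \<noteq> 0" by (elim disjE) (simp_all del: One_nat_def add_2_eq_Suc')
      with that q have "n \<le> q" unfolding mem_S_fam by linarith
      then have "5 * q + 1 \<in> ?A" "5 * q + 2 \<in> ?A" "5 * q + 3 \<in> ?A" "5 * q + 4 \<in> ?A"
        unfolding mem1 mem2 mem3 mem4 using a by auto
      with q False show ?thesis by metis
    qed
  qed
  \<comment> \<open>Only the largest gap \<open>5 * m + r\<close> of each nonzero class needs
    testing: a smaller member of the class would drag it in.\<close>
  have up: "5 * q + r \<in> ?A \<Longrightarrow> q \<le> m \<Longrightarrow> 5 * m + r \<in> ?A" for q r
    unfolding mem by (meson add_le_mono1 add_left_mono order_trans)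
  have "?L \<longleftrightarrow> 5 * m + 1 \<notin> ?A \<and> 5 * m + 2 \<notin> ?A \<and> 5 * m + 3 \<notin> ?A \<and> 5 * m + 4 \<notin> ?A"
  proof
    assume ?L
    show "5 * m + 1 \<notin> ?A \<and> 5 * m + 2 \<notin> ?A \<and> 5 * m + 3 \<notin> ?A \<and> 5 * m + 4 \<notin> ?A"
      unfolding \<open>?L\<close> mem_S_fam m by (auto simp del: One_nat_def add_Suc_right add_2_eq_Suc')
  next
    assume gaps: "5 * m + 1 \<notin> ?A \<and> 5 * m + 2 \<notin> ?A \<and> 5 * m + 3 \<notin> ?A \<and> 5 * m + 4 \<notin> ?A"
    have "x \<in> S_fam n" if "x \<in> ?A" for x
    proof (rule ccontr)
      assume "x \<notin> S_fam n"
      then have x: "x mod 5 \<noteq> 0" "x < 5 * n" by (auto simp: mem_S_fam)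
      obtain q where q: "x = 5 * q \<or> x = 5 * q + 1 \<or> x = 5 * q + 2 \<or> x = 5 * q + 3 \<or> x = 5 * q + 4"
        using rep by blast
      with x have "x \<noteq> 5 * q" "q \<le> m" unfolding m by auto
      with q up[of q] gaps that show False by metis
    qed
    with S_sub show ?L by blast
  qed
  also have "\<dots> \<longleftrightarrow> ?R"
  proof -
    \<comment> \<open>As \<open>n = Suc m\<close>, inequalities with slack \<open>m\<close> between
      values at most \<open>n\<close> can fail only at the extreme values 0 and
      \<open>n\<close>.\<close>
    have eqs: "i \<le> m \<longleftrightarrow> i \<noteq> n" "n \<le> i + m \<longleftrightarrow> i \<noteq> 0" "i \<le> Suc (j + m)"
      "i \<le> j + m \<longleftrightarrow> \<not> (j = 0 \<and> i = n)" if "i \<le> n" for i j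
      using that unfolding m by auto
    have "\<not> n \<le> m" unfolding m by simp
    then show ?thesis
      unfolding mem1 mem2 mem3 mem4 eqs(1)[OF a(3)] eqs(1)[OF a(4)] eqs(1)[OF a(5)]
        eqs(2)[OF a(3)] eqs(2)[OF a(4)] eqs(2)[OF a(5)]
        eqs(4)[OF a(3)] eqs(4)[OF a(4)] eqs(4)[OF a(5)]
      using eqs(3)[OF a(3)] n by (metis not_one_le_zero)
  qed
  finally show ?thesis .
qed

section \<open>Admissible triples and the count\<close>

text \<open>The triple holds the free values at residues 1, 2, 3; the outer entries are forced.
  \<open>residue_set 5\<close> looks up only remainders modulo 5, which are valid list
  indices.\<close>

definition thresholds :: "nat \<Rightarrow> nat \<times> nat \<times> nat \<Rightarrow> nat \<Rightarrow> nat" where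
  "thresholds n p r = (case p of (b, c, d) \<Rightarrow> [0, b, c, d, n] ! r)"

lemma thresholds_simps [simp]:
  "thresholds n (b, c, d) 0 = 0"
  "thresholds n (b, c, d) (Suc 0) = b"
  "thresholds n (b, c, d) 2 = c"
  "thresholds n (b, c, d) 3 = d"
  "thresholds n (b, c, d) 4 = n"
  by (simp_all add: thresholds_def numeral_eq_Suc)

definition admissible :: "nat \<Rightarrow> (nat \<times> nat \<times> nat) set" where
  "admissible n = (\<lambda>i. (i, 0, n)) ` {..n} \<union> (\<lambda>i. (0, n, i)) ` {..n} \<union> {(0, 0, 0), (n, n, n)}"

text \<open>For \<open>n \<ge> 1\<close> the middle entry (0 or \<open>n\<close>) separates the two
  families, and neither contains \<open>(0, 0, 0)\<close> or \<open>(n, n, n)\<close>.\<close>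

lemma card_admissible:
  assumes "n \<ge> 1"
  shows "card (admissible n) = 2 * n + 4"
proof -
  have "card ((\<lambda>i. (i, 0, n)) ` {..n} \<union> (\<lambda>i. (0, n, i)) ` {..n}) = (n + 1) + (n + 1)"
    using assms by (subst card_Un_disjoint) (auto simp: card_image inj_on_def)
  moreover have "card {(0, 0, 0), (n, n, n)} = 2"
    using assms by simp
  ultimately show ?thesis
    unfolding admissible_def using assms by (subst card_Un_disjoint) auto
qed

lemma inj_residue_set_thresholds: "inj (\<lambda>p. residue_set 5 (thresholds n p))"
proof (rule injI)
  fix p p' assume eq: "residue_set 5 (thresholds n p) = residue_set 5 (thresholds n p')"
  obtain b c d b' c' d' where "p = (b, c, d)" "p' = (b', c', d')" by (metis prod_cases3)
  then show "p = p'"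
    using residue_set_eqD[OF eq, of 1] residue_set_eqD[OF eq, of 2] residue_set_eqD[OF eq, of 3]
    by simp
qed

lemma numerical_set_residue_set:
  assumes "m > 0" "a 0 = 0"
  shows "numerical_set (residue_set m a)"
proof -
  \<comment> \<open>The sum serves as a common upper bound for all thresholds.\<close>
  have "x < m * (\<Sum>r<m. a r)" if "x \<notin> residue_set m a" for x
  proof -
    have "x div m < a (x mod m)" using that by (simp add: residue_set_def)
    also have "\<dots> \<le> (\<Sum>r<m. a r)" using assms by (intro member_le_sum) auto
    finally show ?thesis using assms by (simp add: div_less_iff_less_mult mult.commute)
  qed
  then have "- residue_set m a \<subseteq> {..<m * (\<Sum>r<m. a r)}" by auto
  then have "finite (- residue_set m a)" by (rule finite_subset) simp
  with assms show ?thesis by (simp add: numerical_set_def residue_set_def)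
qed

lemma associated_residue_set:
  assumes n: "n \<ge> 1" and T: "numerical_set T" "atom_monoid T = S_fam n"
  obtains a where "T = residue_set 5 a" "a 0 = 0" "a 4 = n" "\<And>r. r < 5 \<Longrightarrow> a r \<le> n"
proof
  have add: "s + t \<in> T" if "s \<in> S_fam n" "t \<in> T" for s t
    using that unfolding T(2)[symmetric] atom_monoid_def by blast
  have "0 \<in> T" using T(1) by (simp add: numerical_set_def)
  with add[of _ 0] have S_sub: "S_fam n \<subseteq> T" by auto
  let ?a = "\<lambda>r. LEAST k. 5 * k + r \<in> T"
  have top: "5 * n + r \<in> T" for r using S_sub by (auto simp: mem_S_fam)
  show "T = residue_set 5 ?a"
    using add[of 5] top by (intro residue_set_Least) (auto simp: mem_S_fam)
  show "?a 0 = 0" using \<open>0 \<in> T\<close> by simp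
  show le: "?a r \<le> n" for r using top by (rule Least_le)
  have gap: "5 * n - 1 \<notin> T"
  proof
    assume gap: "5 * n - 1 \<in> T"
    \<comment> \<open>For \<open>t = 0\<close> this is the assumption; for positive \<open>t\<close>
      the sum is at least \<open>5 * n\<close>.\<close>
    have "5 * n - 1 + t \<in> T" if "t \<in> T" for t
      using gap top[of "t - 1"] n by (cases t) auto
    then have "5 * n - 1 \<in> S_fam n" unfolding T(2)[symmetric] atom_monoid_def by blast
    moreover obtain m where "n = Suc m" using n by (cases n) auto
    moreover have "5 * Suc m - 1 = 5 * m + 4" for m by simp
    ultimately show False by (simp add: mem_S_fam)
  qed
  have "5 * ?a 4 + 4 \<in> T" using top by (rule LeastI)
  show "?a 4 = n"
  proof (rule ccontr)
    assume "?a 4 \<noteq> n"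
    with le[of 4] have "?a 4 < n" by simp
    \<comment> \<open>Adding a multiple of 5 to the least element of class 4 would reach the gap
      \<open>5 * n - 1\<close>.\<close>
    then have "5 * (n - 1 - ?a 4) + (5 * ?a 4 + 4) = 5 * n - 1" by simp
    moreover have "5 * (n - 1 - ?a 4) + (5 * ?a 4 + 4) \<in> T"
      by (rule add) (use \<open>5 * ?a 4 + 4 \<in> T\<close> in \<open>simp_all add: mem_S_fam\<close>)
    ultimately show False using gap by simp
  qed
qed

lemma associated_sets_S_fam:
  assumes n: "n \<ge> 1"
  shows "{T. numerical_set T \<and> atom_monoid T = S_fam n} =
    (\<lambda>p. residue_set 5 (thresholds n p)) ` admissible n"
proof (intro set_eqI iffI)
  fix T assume "T \<in> {T. numerical_set T \<and> atom_monoid T = S_fam n}"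
  then have T: "numerical_set T" "atom_monoid T = S_fam n" by auto
  obtain a where a: "T = residue_set 5 a" "a 0 = 0" "a 4 = n" and le: "\<And>r. r < 5 \<Longrightarrow> a r \<le> n"
    using associated_residue_set[OF n T] by blast
  have "residue_set 5 a = residue_set 5 (thresholds n (a 1, a 2, a 3))"
  proof (rule residue_set_cong)
    have "\<forall>r<5. a r = thresholds n (a 1, a 2, a 3) r"
      unfolding all_less_5 using a by simp
    then show "a r = thresholds n (a 1, a 2, a 3) r" if "r < 5" for r using that by blast
  qed simp
  \<comment> \<open>If \<open>a 2 = 0\<close>, either \<open>a 3 = n\<close> or both others vanish;
    if \<open>a 2 = n\<close>, either \<open>a 1 = 0\<close> or both others equal \<open>n\<close>.
    Any other \<open>a 2\<close> forces \<open>a 1 = 0\<close> and \<open>a 3 = n\<close>, violating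
    the third conjunct.\<close>
  moreover have "(a 1, a 2, a 3) \<in> admissible n"
    using atom_monoid_residue_set_eq_S_fam[OF n a(2,3)] T(2) a le[of 1] le[of 2] le[of 3]
    by (auto simp: admissible_def)
  ultimately show "T \<in> (\<lambda>p. residue_set 5 (thresholds n p)) ` admissible n"
    using a by blast
next
  fix T assume "T \<in> (\<lambda>p. residue_set 5 (thresholds n p)) ` admissible n"
  then obtain b c d where T: "T = residue_set 5 (thresholds n (b, c, d))" "(b, c, d) \<in> admissible n"
    by auto
  have "atom_monoid T = S_fam n"
    using T(2) unfolding T(1) admissible_def
    by (subst atom_monoid_residue_set_eq_S_fam[OF n]) auto
  with T(1) show "T \<in> {T. numerical_set T \<and> atom_monoid T = S_fam n}"
    by (simp add: numerical_set_residue_set)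
qed

theorem proposition7p1:
  fixes n :: nat
  assumes "n \<ge> 1"
  shows "semigroup_type (S_fam n) = 4 \<and> num_assoc_sets (S_fam n) = 2 * n + 4"
proof
  show "semigroup_type (S_fam n) = 4"
    \<comment> \<open>\<open>n \<ge> 1\<close> keeps the four truncated differences
      distinct.\<close>
    using assms by (auto simp: semigroup_type_def pseudo_frobenius_S_fam card_insert_if)
  have "card ((\<lambda>p. residue_set 5 (thresholds n p)) ` admissible n) = card (admissible n)"
    by (rule card_image) (use inj_residue_set_thresholds in \<open>rule inj_on_subset, simp\<close>)
  then show "num_assoc_sets (S_fam n) = 2 * n + 4"
    using assms by (simp add: num_assoc_sets_def associated_sets_S_fam card_admissible)
qed

end
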